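(* Let $A\in\mathbb{R}^{N\times N}$ have full rank, let $b\in\mathbb{R}^N$, and let $w_1,\dots,w_N$ be the orthonormal vectors generated by the Arnoldi algorithm applied to $A$ and $b$. For $1\le m<N$ let $W_m=[w_1,\dots,w_m]$, $W_{m+1}=[w_1,\dots,w_{m+1}]$, $W_m^{\bot}=[w_{m+1},\dots,w_N]$, and let $\overline H_m\in\mathbb{R}^{(m+1)\times m}$ be the Arnoldi matrix satisfying $AW_m=W_{m+1}\overline H_m$. For $1\le k\le m$, let $\sigma_k^{(m)}$ be a singular value of $\overline H_m$ with unit singular vectors $u_k^{(m)}\in\mathbb{R}^{m+1}$ and $v_k^{(m)}\in\mathbb{R}^m$, that is, $\overline H_mv_k^{(m)}=\sigma_k^{(m)}u_k^{(m)}$ and $\overline H_m^Tu_k^{(m)}=\sigma_k^{(m)}v_k^{(m)}$, and define $\overline u_k=W_{m+1}u_k^{(m)}$ and $\overline v_k=W_mv_k^{(m)}$. Then $$\left\|A^T\overline u_k-\sigma_k^{(m)}\overline v_k\right\|\le\left\|W_{m+1}^TAW_m^{\bot}\right\|.$$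
   Context: The Arnoldi algorithm applied to $A$ and $b$ builds (in exact arithmetic), for each $m$, an orthonormal basis $w_1,\dots,w_m$ of the Krylov subspace $\mathcal{K}_m(A,b)=\mathrm{span}\{b,Ab,\dots,A^{m-1}b\}$, starting from $w_1=b/\|b\|$. With $W_m=[w_1,\dots,w_m]$ it satisfies $AW_m=W_mH_m+h_{m+1,m}w_{m+1}e_m^T$, where $H_m=(h_{i,j})\in\mathbb{R}^{m\times m}$ is upper Hessenberg and $e_m=(0,\dots,0,1)^T\in\mathbb{R}^m$; equivalently $AW_m=W_{m+1}\overline H_m$ with $\overline H_m=\begin{bmatrix}H_m\\ h_{m+1,m}e_m^T\end{bmatrix}$. It is assumed that the process does not terminate before $w_1,\dots,w_N$ have all been produced (i.e. $h_{j+1,j}\ne0$ for $1\le j\le N-1$), so that these vectors form an orthonormal basis of $\mathbb{R}^N$. The norm is the Euclidean norm (spectral norm for matrices). *)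

theory Defs
  imports Complex_Main "Jordan_Normal_Form.DL_Rank"
begin

definition vec_norm2 :: "real vec \<Rightarrow> real" where
  "vec_norm2 v = sqrt (v \<bullet> v)"

(* The operator norm induced by vec_norm2. Using the closed unit ball instead of the
   unit sphere keeps the supremum well-defined (equal to 0) for matrices without columns. *)
definition spectral_norm :: "real mat \<Rightarrow> real" where
  "spectral_norm M = (SUP x \<in> {x \<in> carrier_vec (dim_col M). vec_norm2 x \<le> 1}. vec_norm2 (M *\<^sub>v x))"

definition normalize_vec :: "real vec \<Rightarrow> real vec" where
  "normalize_vec v = (1 / vec_norm2 v) \<cdot>\<^sub>v v"

(* Arnoldi's algorithm in exact arithmetic. All indices are shifted down by one, in line with
   the matrix library: z_0 = b and w_j = z_j / ||z_j||, where
   z_(j+1) = A w_j - sum_(i <= j) h_(i,j) w_i  with  h_(i,j) = <w_i, A w_j>  and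
   h_(j+1,j) = ||z_(j+1)||. The algorithm terminates as soon as some z_j is 0; from that point
   on the values of the (total) functions below carry no meaning. *)
fun arnoldi_residual :: "real mat \<Rightarrow> real vec \<Rightarrow> nat \<Rightarrow> real vec" where
  "arnoldi_residual A b 0 = b"
| "arnoldi_residual A b (Suc j) =
    (let y = A *\<^sub>v normalize_vec (arnoldi_residual A b j)
     in vec (dim_row A) (\<lambda>r. y $ r -
          (\<Sum>i\<le>j. (normalize_vec (arnoldi_residual A b i) \<bullet> y)
                   * normalize_vec (arnoldi_residual A b i) $ r)))"

definition arnoldi_vec :: "real mat \<Rightarrow> real vec \<Rightarrow> nat \<Rightarrow> real vec" where
  "arnoldi_vec A b j = normalize_vec (arnoldi_residual A b j)"

definition arnoldi_coeff :: "real mat \<Rightarrow> real vec \<Rightarrow> nat \<Rightarrow> nat \<Rightarrow> real" where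
  "arnoldi_coeff A b i j =
    (if i \<le> j then arnoldi_vec A b i \<bullet> (A *\<^sub>v arnoldi_vec A b j)
     else if i = Suc j then vec_norm2 (arnoldi_residual A b (Suc j))
     else 0)"

(* The process produces w_1, ..., w_N (1-based): w_1 exists iff b is nonzero. *)
definition arnoldi_no_breakdown :: "nat \<Rightarrow> real mat \<Rightarrow> real vec \<Rightarrow> bool" where
  "arnoldi_no_breakdown N A b \<longleftrightarrow>
    b \<noteq> 0\<^sub>v N \<and> (\<forall>j. Suc j < N \<longrightarrow> arnoldi_coeff A b (Suc j) j \<noteq> 0)"

definition arnoldi_W :: "real mat \<Rightarrow> real vec \<Rightarrow> nat \<Rightarrow> real mat" where
  "arnoldi_W A b m = mat_of_cols (dim_row A) (map (arnoldi_vec A b) [0..<m])"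

definition arnoldi_W_perp :: "real mat \<Rightarrow> real vec \<Rightarrow> nat \<Rightarrow> real mat" where
  "arnoldi_W_perp A b m = mat_of_cols (dim_row A) (map (arnoldi_vec A b) [m..<dim_row A])"

definition arnoldi_Hbar :: "real mat \<Rightarrow> real vec \<Rightarrow> nat \<Rightarrow> real mat" where
  "arnoldi_Hbar A b m = mat (m + 1) m (\<lambda>(i, j). arnoldi_coeff A b i j)"

definition singular_triplet :: "real mat \<Rightarrow> real \<Rightarrow> real vec \<Rightarrow> real vec \<Rightarrow> bool" where
  "singular_triplet M \<sigma> u v \<longleftrightarrow>
    \<sigma> \<ge> 0 \<and>
    u \<in> carrier_vec (dim_row M) \<and> vec_norm2 u = 1 \<and>
    v \<in> carrier_vec (dim_col M) \<and> vec_norm2 v = 1 \<and>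
    M *\<^sub>v v = \<sigma> \<cdot>\<^sub>v u \<and> M\<^sup>T *\<^sub>v u = \<sigma> \<cdot>\<^sub>v v"

end

theory Submission
  imports Defs
begin

text \<open>
  In the orthonormal basis $w_1, \dots, w_N$ the residual $A^T \overline u_k - \sigma_k \overline v_k$
  has vanishing first $m$ coordinates, because
  $\langle w_j, A^T \overline u_k\rangle = \langle W_{m+1} \overline H_m e_j, W_{m+1} u_k\rangle
  = (\overline H_m^T u_k)_j = \sigma_k (v_k)_j$; the remaining ones form the vector $M^T u_k$ with
  $M = W_{m+1}^T A W_m^\bot$. Its norm is at most $\|M^T\| = \|M\|$.
\<close>

section \<open>Euclidean and spectral norm\<close>

lemma scalar_prod_self_nonneg: "(x :: real vec) \<bullet> x \<ge> 0"
  by (simp add: scalar_prod_def sum_nonneg)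

lemma scalar_prod_self_eq_0:
  assumes "x \<in> carrier_vec n" "(x :: real vec) \<bullet> x = 0"
  shows "x = 0\<^sub>v n"
  using assms by (intro eq_vecI) (auto simp: scalar_prod_def sum_nonneg_eq_0_iff)

lemma vec_norm2_nonneg [simp]: "vec_norm2 x \<ge> 0"
  by (simp add: vec_norm2_def scalar_prod_self_nonneg)

lemma vec_norm2_power2: "(vec_norm2 x)\<^sup>2 = x \<bullet> x"
  by (simp add: vec_norm2_def scalar_prod_self_nonneg)

lemma vec_norm2_zero [simp]: "vec_norm2 (0\<^sub>v n) = 0"
  by (simp add: vec_norm2_def)

lemma vec_norm2_smult: "vec_norm2 (c \<cdot>\<^sub>v x) = \<bar>c\<bar> * vec_norm2 x"
proof -
  have "(c \<cdot>\<^sub>v x) \<bullet> (c \<cdot>\<^sub>v x) = c\<^sup>2 * (x \<bullet> x)"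
    by (simp add: scalar_prod_def sum_distrib_left power2_eq_square algebra_simps)
  then show ?thesis by (simp add: vec_norm2_def real_sqrt_mult)
qed

lemma vec_norm2_eq_0:
  assumes "x \<in> carrier_vec n" "vec_norm2 x = 0"
  shows "x = 0\<^sub>v n"
  using assms(2) by (intro scalar_prod_self_eq_0 assms(1)) (simp add: vec_norm2_def)

lemma vec_norm2_normalize_vec:
  assumes "vec_norm2 x \<noteq> 0"
  shows "vec_norm2 (normalize_vec x) = 1"
  using assms by (simp add: normalize_vec_def vec_norm2_smult)

lemma smult_normalize_vec:
  assumes "vec_norm2 x \<noteq> 0"
  shows "vec_norm2 x \<cdot>\<^sub>v normalize_vec x = x"
  using assms by (simp add: normalize_vec_def smult_smult_assoc)

lemma normalize_vec_carrier [simp]: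
  "normalize_vec x \<in> carrier_vec n \<longleftrightarrow> x \<in> carrier_vec n"
  by (simp add: normalize_vec_def)

text \<open>Cauchy-Schwarz. With \<open>b\<close> = <y,y> and \<open>c\<close> = <x,y>, the vector b
  x - c y is \<open>b\<close> times the component of x orthogonal to y. Its squared norm b (a b -
  c^2) is nonnegative, and dividing by b > 0 leaves c^2 \<le> a b. The degenerate case b = 0 forces
  y = 0.\<close>

lemma scalar_prod_le_vec_norm2:
  assumes x: "x \<in> carrier_vec n" and y: "y \<in> carrier_vec n"
  shows "\<bar>x \<bullet> y\<bar> \<le> vec_norm2 x * vec_norm2 y"
proof (cases "y \<bullet> y = 0")
  case True
  then have "y = 0\<^sub>v n" by (rule scalar_prod_self_eq_0[OF y])
  then show ?thesis using x by simp
next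
  case False
  define a b c where "a = x \<bullet> x" and "b = y \<bullet> y" and "c = x \<bullet> y"
  have "(b \<cdot>\<^sub>v x - c \<cdot>\<^sub>v y) \<bullet> (b \<cdot>\<^sub>v x - c \<cdot>\<^sub>v y) = b * b * a - 2 * b * c * c + c * c * b"
    using x y comm_scalar_prod[OF y x]
    by (simp add: minus_scalar_prod_distrib[where n = n] scalar_prod_minus_distrib[where n = n]
        a_def b_def c_def algebra_simps)
  also have "\<dots> = b * (a * b - c\<^sup>2)" by (simp add: power2_eq_square algebra_simps)
  finally have "0 \<le> b * (a * b - c\<^sup>2)"
    using scalar_prod_self_nonneg[of "b \<cdot>\<^sub>v x - c \<cdot>\<^sub>v y"] by simp
  moreover have "b > 0" using False scalar_prod_self_nonneg[of y] by (simp add: b_def)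
  ultimately have "c\<^sup>2 \<le> a * b" by (simp add: zero_le_mult_iff)
  then have "\<bar>c\<bar> \<le> sqrt (a * b)" using real_le_rsqrt[of "\<bar>c\<bar>"] by simp
  then show ?thesis by (simp add: a_def b_def c_def vec_norm2_def real_sqrt_mult)
qed

section \<open>The spectral norm as an operator norm\<close>

lemma bdd_above_vec_norm2_mult_unit_ball:
  "bdd_above ((\<lambda>x. vec_norm2 (M *\<^sub>v x)) ` {x \<in> carrier_vec (dim_col M). vec_norm2 x \<le> 1})"
proof (intro bdd_aboveI2)
  fix x assume x: "x \<in> {x \<in> carrier_vec (dim_col M). vec_norm2 x \<le> 1}"
  \<comment> \<open>Cauchy-Schwarz on each row; summing over the rows bounds the image of the unit
    ball by the Frobenius norm. A bound of this kind is what lets the real supremum in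
    \<open>spectral_norm\<close> act as an upper bound.\<close>
  have "(row M i \<bullet> x)\<^sup>2 \<le> (vec_norm2 (row M i))\<^sup>2" for i
  proof -
    have "\<bar>row M i \<bullet> x\<bar> \<le> vec_norm2 (row M i) * vec_norm2 x"
      using x by (intro scalar_prod_le_vec_norm2[where n = "dim_col M"]) auto
    also have "\<dots> \<le> vec_norm2 (row M i)" using x by (intro mult_left_le) auto
    finally show ?thesis by (metis abs_ge_zero power2_abs power_mono)
  qed
  then have "(M *\<^sub>v x) \<bullet> (M *\<^sub>v x) \<le> (\<Sum>i<dim_row M. (vec_norm2 (row M i))\<^sup>2)"
    by (simp add: scalar_prod_def[of "M *\<^sub>v x"] power2_eq_square[symmetric] lessThan_atLeast0 sum_mono)
  then show "vec_norm2 (M *\<^sub>v x) \<le> sqrt (\<Sum>i<dim_row M. (vec_norm2 (row M i))\<^sup>2)"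
    by (simp add: vec_norm2_def)
qed

text \<open>Both sides are homogeneous in x, so the claim reduces to the unit vector
  \<open>normalize_vec x\<close>, at which the supremum applies directly. The zero vector is split
  off because it cannot be normalized.\<close>

lemma vec_norm2_mult_mat_vec_le:
  assumes M: "M \<in> carrier_mat nr nc" and x: "x \<in> carrier_vec nc"
  shows "vec_norm2 (M *\<^sub>v x) \<le> spectral_norm M * vec_norm2 x"
proof (cases "vec_norm2 x = 0")
  case True
  then have "x = 0\<^sub>v nc" using x by (simp add: vec_norm2_eq_0)
  moreover have "M *\<^sub>v 0\<^sub>v nc = 0\<^sub>v nr" using M by auto
  ultimately show ?thesis by simp
next
  case False
  have n: "normalize_vec x \<in> carrier_vec nc" using x by simp
  have "vec_norm2 (M *\<^sub>v normalize_vec x) \<le> spectral_norm M"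
    unfolding spectral_norm_def
    using M n vec_norm2_normalize_vec[OF False]
    by (intro cSUP_upper bdd_above_vec_norm2_mult_unit_ball) auto
  then have "vec_norm2 x * vec_norm2 (M *\<^sub>v normalize_vec x) \<le> spectral_norm M * vec_norm2 x"
    by (subst mult.commute) (intro mult_right_mono vec_norm2_nonneg)
  moreover have "M *\<^sub>v x = vec_norm2 x \<cdot>\<^sub>v (M *\<^sub>v normalize_vec x)"
    using mult_mat_vec[OF M n, of "vec_norm2 x"] unfolding smult_normalize_vec[OF False] .
  ultimately show ?thesis by (metis vec_norm2_smult abs_of_nonneg vec_norm2_nonneg)
qed

text \<open>The inequality between the norm of a transpose and that of M, by duality: for y = M^T u
  one has <y,y> = <u, M y>, which Cauchy-Schwarz and the operator norm bound estimate by |u| |M|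
  |y|. One factor |y| then cancels.\<close>

lemma vec_norm2_transpose_mult_le:
  assumes M: "M \<in> carrier_mat nr nc" and u: "u \<in> carrier_vec nr"
  shows "vec_norm2 (M\<^sup>T *\<^sub>v u) \<le> spectral_norm M * vec_norm2 u"
proof -
  define y where "y = M\<^sup>T *\<^sub>v u"
  have y: "y \<in> carrier_vec nc" using M u by (auto simp: y_def)
  have "vec_norm2 y * vec_norm2 y = (M\<^sup>T *\<^sub>v u) \<bullet> y"
    using vec_norm2_power2[of y] by (simp add: power2_eq_square y_def)
  also have "\<dots> = u \<bullet> (M *\<^sub>v y)" using transpose_vec_mult_scalar[OF M y u] .
  also have "\<dots> \<le> vec_norm2 u * vec_norm2 (M *\<^sub>v y)"
    using scalar_prod_le_vec_norm2[OF u mult_mat_vec_carrier[OF M y]] by simp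
  also have "\<dots> \<le> vec_norm2 u * (spectral_norm M * vec_norm2 y)"
    using vec_norm2_mult_mat_vec_le[OF M y] by (simp add: mult_left_mono)
  finally have *: "vec_norm2 y * vec_norm2 y \<le> (spectral_norm M * vec_norm2 u) * vec_norm2 y"
    by (simp add: mult_ac)
  \<comment> \<open>The zero vector lies in the unit ball, so the supremum is nonnegative. This
    settles the case y = 0, where no factor can be cancelled.\<close>
  have "vec_norm2 (M *\<^sub>v 0\<^sub>v (dim_col M)) \<le> spectral_norm M"
    unfolding spectral_norm_def by (intro cSUP_upper bdd_above_vec_norm2_mult_unit_ball) simp
  then have "0 \<le> spectral_norm M" by (rule order_trans[OF vec_norm2_nonneg])
  then have nonneg: "0 \<le> spectral_norm M * vec_norm2 u" by simp
  show ?thesis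
  proof (cases "vec_norm2 y = 0")
    case True
    then show ?thesis using nonneg by (simp add: y_def)
  next
    case False
    then have "0 < vec_norm2 y" using vec_norm2_nonneg[of y] by linarith
    then show ?thesis using mult_right_le_imp_le[OF *] by (simp add: y_def)
  qed
qed

text \<open>As \<open>Q\<close> is square, its left inverse Q^T is also a right inverse, so <Q^T x,
  Q^T x> = <x, Q Q^T x> = <x,x>. Applied to the Arnoldi basis this is Parseval's identity.\<close>

lemma vec_norm2_transpose_mult_orthogonal:
  assumes Q: "Q \<in> carrier_mat n n" and orth: "Q\<^sup>T * Q = 1\<^sub>m n" and x: "x \<in> carrier_vec n"
  shows "vec_norm2 (Q\<^sup>T *\<^sub>v x) = vec_norm2 x"
proof -
  have "Q * Q\<^sup>T = 1\<^sub>m n" using mat_mult_left_right_inverse[of "Q\<^sup>T" n Q] Q orth by simp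
  then have "Q *\<^sub>v (Q\<^sup>T *\<^sub>v x) = x"
    using Q x by (metis assoc_mult_mat_vec one_mult_mat_vec transpose_carrier_mat)
  then have "(Q\<^sup>T *\<^sub>v x) \<bullet> (Q\<^sup>T *\<^sub>v x) = x \<bullet> x"
    using transpose_vec_mult_scalar[OF Q, of "Q\<^sup>T *\<^sub>v x" x] Q x by simp
  then show ?thesis by (simp add: vec_norm2_def)
qed

section \<open>Arnoldi vectors\<close>

lemma arnoldi_residual_carrier:
  assumes "A \<in> carrier_mat N N" "b \<in> carrier_vec N"
  shows "arnoldi_residual A b j \<in> carrier_vec N"
  using assms by (cases j) (auto simp: Let_def)

lemma arnoldi_vec_carrier:
  assumes "A \<in> carrier_mat N N" "b \<in> carrier_vec N"
  shows "arnoldi_vec A b j \<in> carrier_vec N"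
  using arnoldi_residual_carrier[OF assms] by (simp add: arnoldi_vec_def)

text \<open>The recursion in terms of Arnoldi vectors and coefficients. Later proofs use this form
  and keep the defining equations of the residual out of the simplifier.\<close>

lemma arnoldi_residual_Suc_index:
  assumes "A \<in> carrier_mat N N" "r < N"
  shows "arnoldi_residual A b (Suc j) $ r = (A *\<^sub>v arnoldi_vec A b j) $ r -
    (\<Sum>i\<le>j. arnoldi_coeff A b i j * arnoldi_vec A b i $ r)"
  using assms by (simp add: Let_def arnoldi_vec_def arnoldi_coeff_def)

text \<open>Index 0 is covered by \<open>b\<close> being nonzero; for a successor index the norm is
  itself the subdiagonal coefficient, which the absence of breakdown keeps away from 0.\<close>

lemma arnoldi_residual_nonzero:
  assumes "b \<in> carrier_vec N" "arnoldi_no_breakdown N A b" "j < N"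
  shows "vec_norm2 (arnoldi_residual A b j) \<noteq> 0"
proof (cases j)
  case 0
  then show ?thesis using assms vec_norm2_eq_0[of b N] by (auto simp: arnoldi_no_breakdown_def)
next
  case (Suc i)
  then have "arnoldi_coeff A b (Suc i) i \<noteq> 0" using assms by (auto simp: arnoldi_no_breakdown_def)
  then show ?thesis using Suc by (simp add: arnoldi_coeff_def del: arnoldi_residual.simps)
qed

lemma arnoldi_residual_eq_smult:
  assumes "b \<in> carrier_vec N" "arnoldi_no_breakdown N A b" "j < N"
  shows "arnoldi_residual A b j = vec_norm2 (arnoldi_residual A b j) \<cdot>\<^sub>v arnoldi_vec A b j"
  unfolding arnoldi_vec_def using smult_normalize_vec[OF arnoldi_residual_nonzero[OF assms]] by simp

text \<open>Gram-Schmidt by strong induction: subtracting the projections onto all earlier vectors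
  makes each new residual orthogonal to them, and normalizing a nonzero residual preserves
  this.\<close>

lemma arnoldi_vec_orthonormal:
  assumes A: "A \<in> carrier_mat N N" and b: "b \<in> carrier_vec N"
    and nb: "arnoldi_no_breakdown N A b" and "i < N" "j < N"
  shows "arnoldi_vec A b i \<bullet> arnoldi_vec A b j = (if i = j then 1 else 0)"
proof -
  let ?w = "arnoldi_vec A b"
  note w = arnoldi_vec_carrier[OF A b]
  have unit: "?w j \<bullet> ?w j = 1" if "j < N" for j
    using vec_norm2_power2[of "?w j"] vec_norm2_normalize_vec[OF arnoldi_residual_nonzero[OF b nb that]]
    by (simp add: arnoldi_vec_def)
  have less: "j < N \<Longrightarrow> \<forall>i<j. ?w i \<bullet> ?w j = 0" for j
  proof (induction j rule: less_induct)
    case (less j)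
    \<comment> \<open>The induction hypothesis gives the pairs with i < l; symmetry and unit length
      give the others.\<close>
    have ortho: "?w i \<bullet> ?w l = (if i = l then 1 else 0)" if "i < j" "l < j" for i l
      using that less unit comm_scalar_prod[OF w w, of i l]
      by (metis linorder_neqE_nat order.strict_trans)
    show ?case
    proof (intro allI impI)
      fix i assume "i < j"
      then obtain k where k: "j = Suc k" "i \<le> k" by (cases j) auto
      let ?y = "A *\<^sub>v ?w k" and ?z = "arnoldi_residual A b j"
      have "?w i \<bullet> ?z = (\<Sum>r<N. ?w i $ r * ?z $ r)"
        using arnoldi_residual_carrier[OF A b, of j]
        by (simp add: scalar_prod_def lessThan_atLeast0)
      also have "\<dots> = (\<Sum>r<N. ?w i $ r * ?y $ r)
          - (\<Sum>r<N. \<Sum>l\<le>k. arnoldi_coeff A b l k * (?w i $ r * ?w l $ r))"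
        unfolding k(1) sum_subtractf[symmetric]
        by (rule sum.cong) (simp_all add: arnoldi_residual_Suc_index[OF A] right_diff_distrib
            sum_distrib_left mult_ac del: arnoldi_residual.simps)
      also have "(\<Sum>r<N. ?w i $ r * ?y $ r) = ?w i \<bullet> ?y"
        using A by (simp add: scalar_prod_def lessThan_atLeast0)
      also have "(\<Sum>r<N. \<Sum>l\<le>k. arnoldi_coeff A b l k * (?w i $ r * ?w l $ r))
          = (\<Sum>l\<le>k. arnoldi_coeff A b l k * (?w i \<bullet> ?w l))"
        using w by (subst sum.swap) (simp add: scalar_prod_def lessThan_atLeast0 sum_distrib_left carrier_vecD[OF w])
      \<comment> \<open>Orthonormality leaves only the term l = i, whose coefficient is exactly
        <w_i, A w_k>, so the two sums cancel.\<close>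
      also have "\<dots> = (\<Sum>l\<le>k. if l = i then arnoldi_coeff A b l k else 0)"
        using k ortho by (intro sum.cong) auto
      also have "\<dots> = ?w i \<bullet> ?y" using k by (simp add: arnoldi_coeff_def)
      finally have "?w i \<bullet> ?z = 0" by simp
      \<comment> \<open>The residual is a nonzero multiple of \<open>?w j\<close>, so its
        orthogonality to \<open>?w i\<close> passes to \<open>?w j\<close>.\<close>
      moreover have "?w i \<bullet> ?z = vec_norm2 ?z * (?w i \<bullet> ?w j)"
        using arnoldi_residual_eq_smult[OF b nb less.prems] w
        by (metis scalar_prod_smult_distrib)
      ultimately show "?w i \<bullet> ?w j = 0" using arnoldi_residual_nonzero[OF b nb less.prems] by simp
    qed
  qed
  show ?thesis
    using assms(4,5) unit less comm_scalar_prod[OF w w, of i j] by (metis linorder_neqE_nat)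
qed

section \<open>Matrices with Arnoldi vectors as columns\<close>

lemma arnoldi_W_carrier:
  assumes "A \<in> carrier_mat N N"
  shows "arnoldi_W A b n \<in> carrier_mat N n"
  using assms by (intro carrier_matI) (simp_all add: arnoldi_W_def)

lemma col_arnoldi_W:
  assumes "A \<in> carrier_mat N N" "b \<in> carrier_vec N" "j < n"
  shows "col (arnoldi_W A b n) j = arnoldi_vec A b j"
  using assms arnoldi_vec_carrier[OF assms(1,2)] by (simp add: arnoldi_W_def)

text \<open>Moving W to the other side, W^T w_j is a unit vector or zero according to whether j < n.
  Allowing every j < N serves both the leading and the trailing coordinates of the residual.\<close>

lemma scalar_prod_arnoldi_W_mult:
  assumes A: "A \<in> carrier_mat N N" and b: "b \<in> carrier_vec N"
    and nb: "arnoldi_no_breakdown N A b" and "n \<le> N" "j < N" and y: "y \<in> carrier_vec n"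
  shows "arnoldi_vec A b j \<bullet> (arnoldi_W A b n *\<^sub>v y) = (if j < n then y $ j else 0)"
proof -
  let ?W = "arnoldi_W A b n"
  note W = arnoldi_W_carrier[OF A, of b n] and w = arnoldi_vec_carrier[OF A b, of j]
  have "?W\<^sup>T *\<^sub>v arnoldi_vec A b j = (if j < n then unit_vec n j else 0\<^sub>v n)"
    using W assms by (intro eq_vecI) (auto simp: col_arnoldi_W[OF A b] arnoldi_vec_orthonormal[OF A b nb])
  then show ?thesis
    using transpose_vec_mult_scalar[OF W y w] y by auto
qed

lemma arnoldi_W_transpose_mult_self:
  assumes A: "A \<in> carrier_mat N N" and b: "b \<in> carrier_vec N"
    and nb: "arnoldi_no_breakdown N A b" and "n \<le> N"
  shows "(arnoldi_W A b n)\<^sup>T * arnoldi_W A b n = 1\<^sub>m n"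
  using assms arnoldi_W_carrier[OF A, of b n]
  by (intro eq_matI) (auto simp: col_arnoldi_W[OF A b] arnoldi_vec_orthonormal[OF A b nb])

text \<open>The relation A W_m = W_(m+1) H read column by column; it is the residual recursion
  solved for A w_j.\<close>

lemma arnoldi_relation:
  assumes A: "A \<in> carrier_mat N N" and b: "b \<in> carrier_vec N"
    and nb: "arnoldi_no_breakdown N A b" and "j < m" "m < N"
  shows "A *\<^sub>v arnoldi_vec A b j = arnoldi_W A b (m + 1) *\<^sub>v col (arnoldi_Hbar A b m) j"
proof (rule eq_vecI)
  let ?w = "arnoldi_vec A b" and ?h = "arnoldi_coeff A b"
  note W = arnoldi_W_carrier[OF A, of b "m + 1"]
  show "dim_vec (A *\<^sub>v ?w j) = dim_vec (arnoldi_W A b (m + 1) *\<^sub>v col (arnoldi_Hbar A b m) j)"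
    using A W by simp
  fix r assume "r < dim_vec (arnoldi_W A b (m + 1) *\<^sub>v col (arnoldi_Hbar A b m) j)"
  then have r: "r < N" using W by simp
  have "(arnoldi_W A b (m + 1) *\<^sub>v col (arnoldi_Hbar A b m) j) $ r
      = (\<Sum>i<m + 1. arnoldi_W A b (m + 1) $$ (r, i) * ?h i j)"
    using W r assms by (simp add: scalar_prod_def arnoldi_Hbar_def lessThan_atLeast0)
  also have "\<dots> = (\<Sum>i<m + 1. ?w i $ r * ?h i j)"
    using r A by (intro sum.cong) (auto simp: arnoldi_W_def mat_of_cols_index simp del: upt_Suc)
  \<comment> \<open>Hessenberg form: entries below the subdiagonal vanish. Since j < m, the index
    \<open>Suc j\<close> is still among the m + 1 columns.\<close>
  also have "\<dots> = (\<Sum>i\<le>Suc j. ?w i $ r * ?h i j)"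
    using assms by (intro sum.mono_neutral_right) (auto simp: arnoldi_coeff_def)
  also have "\<dots> = (\<Sum>i\<le>j. ?h i j * ?w i $ r) + vec_norm2 (arnoldi_residual A b (Suc j)) * ?w (Suc j) $ r"
    by (simp add: arnoldi_coeff_def mult.commute del: arnoldi_residual.simps)
  also have "vec_norm2 (arnoldi_residual A b (Suc j)) * ?w (Suc j) $ r = arnoldi_residual A b (Suc j) $ r"
    using arnoldi_residual_eq_smult[OF b nb, of "Suc j"] arnoldi_vec_carrier[OF A b, of "Suc j"] assms r
    by (metis carrier_vecD index_smult_vec(1) Suc_leI le_less_trans)
  finally show "(A *\<^sub>v ?w j) $ r = (arnoldi_W A b (m + 1) *\<^sub>v col (arnoldi_Hbar A b m) j) $ r"
    using arnoldi_residual_Suc_index[OF A r, of b j] by simp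
qed

lemma arnoldi_W_perp_carrier:
  assumes "A \<in> carrier_mat N N"
  shows "arnoldi_W_perp A b m \<in> carrier_mat N (N - m)"
  using assms by (intro carrier_matI) (simp_all add: arnoldi_W_perp_def)

lemma col_arnoldi_W_perp:
  assumes "A \<in> carrier_mat N N" "b \<in> carrier_vec N" "j < N - m"
  shows "col (arnoldi_W_perp A b m) j = arnoldi_vec A b (m + j)"
  using assms arnoldi_vec_carrier[OF assms(1,2)] by (simp add: arnoldi_W_perp_def)

section \<open>Splitting the residual along the Arnoldi basis\<close>

theorem proposition9:
  fixes A :: "real mat" and b :: "real vec" and N m k :: nat
    and \<sigma> :: "nat \<Rightarrow> real" and u v :: "nat \<Rightarrow> real vec"
  assumes "A \<in> carrier_mat N N"
    and "vec_space.rank N A = N"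
    and "b \<in> carrier_vec N"
    and "arnoldi_no_breakdown N A b"
    and "1 \<le> m" and "m < N"
    and "1 \<le> k" and "k \<le> m"
    and "singular_triplet (arnoldi_Hbar A b m) (\<sigma> k) (u k) (v k)"
  shows "vec_norm2 (A\<^sup>T *\<^sub>v (arnoldi_W A b (m + 1) *\<^sub>v u k) - \<sigma> k \<cdot>\<^sub>v (arnoldi_W A b m *\<^sub>v v k))
    \<le> spectral_norm ((arnoldi_W A b (m + 1))\<^sup>T * A * arnoldi_W_perp A b m)"
proof -
  note A = assms(1) and b = assms(3) and nb = assms(4)
  let ?w = "arnoldi_vec A b"
  define W V P H Q where "W = arnoldi_W A b (m + 1)" and "V = arnoldi_W A b m"
    and "P = arnoldi_W_perp A b m" and "H = arnoldi_Hbar A b m" and "Q = arnoldi_W A b N"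
  define x M where "x = A\<^sup>T *\<^sub>v (W *\<^sub>v u k)" and "M = W\<^sup>T * A * P"
  define s where "s = x - \<sigma> k \<cdot>\<^sub>v (V *\<^sub>v v k)"
  have W: "W \<in> carrier_mat N (m + 1)" and V: "V \<in> carrier_mat N m" and Q: "Q \<in> carrier_mat N N"
    and P: "P \<in> carrier_mat N (N - m)"
    unfolding W_def V_def P_def Q_def
    using arnoldi_W_carrier[OF A] arnoldi_W_perp_carrier[OF A] by blast+
  have H: "H \<in> carrier_mat (m + 1) m" by (simp add: H_def arnoldi_Hbar_def)
  have u: "u k \<in> carrier_vec (m + 1)" "vec_norm2 (u k) = 1" and v: "v k \<in> carrier_vec m"
    and Hu: "H\<^sup>T *\<^sub>v u k = \<sigma> k \<cdot>\<^sub>v v k"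
    using assms(9) H unfolding singular_triplet_def H_def by auto
  have w: "?w j \<in> carrier_vec N" for j using arnoldi_vec_carrier[OF A b] .
  have Wu: "W *\<^sub>v u k \<in> carrier_vec N" and Vv: "V *\<^sub>v v k \<in> carrier_vec N"
    using mult_mat_vec_carrier[OF W u(1)] mult_mat_vec_carrier[OF V v] .
  have x: "x \<in> carrier_vec N"
    using mult_mat_vec_carrier[OF _ Wu, of "A\<^sup>T" N] A by (simp add: x_def)
  have s: "s \<in> carrier_vec N" and M: "M \<in> carrier_mat (m + 1) (N - m)"
    using x Vv W A P by (auto simp: s_def M_def)
  \<comment> \<open>Coordinates of \<open>s\<close> for all indices at once: the term in
    \<open>V\<close> contributes only below m, where it must cancel, and is absent from m
    on.\<close>
  have ws: "?w j \<bullet> s = ?w j \<bullet> x - \<sigma> k * (if j < m then v k $ j else 0)" if "j < N" for j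
  proof -
    have "?w j \<bullet> (V *\<^sub>v v k) = (if j < m then v k $ j else 0)"
      unfolding V_def using assms(6) by (intro scalar_prod_arnoldi_W_mult[OF A b nb _ that v]) simp
    then show ?thesis
      using scalar_prod_minus_distrib[OF w x smult_carrier_vec[THEN iffD2, OF Vv]]
        scalar_prod_smult_distrib[OF w Vv] by (simp add: s_def)
  qed
  have low: "?w j \<bullet> s = 0" if j: "j < m" for j
  proof -
    have h: "col H j \<in> carrier_vec (m + 1)" using H by (intro carrier_vecI) simp
    \<comment> \<open>Orthonormality of the m + 1 columns of \<open>W\<close>, available because m <
      N.\<close>
    have Wu_eq: "W\<^sup>T *\<^sub>v (W *\<^sub>v u k) = u k"
      using assoc_mult_mat_vec[OF _ W u(1), of "W\<^sup>T" "m + 1"] W u(1)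
        arnoldi_W_transpose_mult_self[OF A b nb, of "m + 1", folded W_def] assms(6) by simp
    have "?w j \<bullet> x = (A\<^sup>T *\<^sub>v (W *\<^sub>v u k)) \<bullet> ?w j"
      unfolding x_def[symmetric] by (rule comm_scalar_prod[OF w x])
    also have "\<dots> = (W *\<^sub>v u k) \<bullet> (W *\<^sub>v col H j)"
      unfolding transpose_vec_mult_scalar[OF A w Wu]
        arnoldi_relation[OF A b nb j assms(6), folded W_def H_def] ..
    also have "\<dots> = col H j \<bullet> u k"
      unfolding transpose_vec_mult_scalar[OF W h Wu, symmetric] Wu_eq by (rule comm_scalar_prod[OF u(1) h])
    also have "\<dots> = (H\<^sup>T *\<^sub>v u k) $ j" using H j by simp
    also have "\<dots> = \<sigma> k * v k $ j" using Hu v j by simp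
    finally show ?thesis using ws[of j] j assms(6) by simp
  qed
  \<comment> \<open>M^T u_k equals P^T x, and column i of \<open>P\<close> is the Arnoldi vector of
    index m + i. There \<open>x\<close> and \<open>s\<close> have the same coordinate.\<close>
  have high: "(M\<^sup>T *\<^sub>v u k) $ i = ?w (m + i) \<bullet> s" if i: "i < N - m" for i
  proof -
    have "M\<^sup>T = P\<^sup>T * (A\<^sup>T * W)"
      using transpose_mult[of "W\<^sup>T * A" "m + 1" N P] transpose_mult[of "W\<^sup>T" "m + 1" N A] A W P
      by (simp add: M_def)
    also have "\<dots> *\<^sub>v u k = P\<^sup>T *\<^sub>v ((A\<^sup>T * W) *\<^sub>v u k)"
      using A W P u(1) by (intro assoc_mult_mat_vec[of _ "N - m" N _ "m + 1"]) auto
    also have "(A\<^sup>T * W) *\<^sub>v u k = x"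
      unfolding x_def using A W u(1) by (intro assoc_mult_mat_vec[of _ N N _ "m + 1"]) auto
    finally have "M\<^sup>T *\<^sub>v u k = P\<^sup>T *\<^sub>v x" .
    then show ?thesis
      using i P ws[of "m + i"] col_arnoldi_W_perp[OF A b i, folded P_def] by simp
  qed
  \<comment> \<open>Parseval in the full basis \<open>Q\<close>; the vanishing coordinates drop out
    and the shift by m matches the rest with the entries of M^T u_k.\<close>
  have "(vec_norm2 s)\<^sup>2 = (vec_norm2 (Q\<^sup>T *\<^sub>v s))\<^sup>2"
    using vec_norm2_transpose_mult_orthogonal[OF Q _ s] arnoldi_W_transpose_mult_self[OF A b nb, of N]
    by (simp add: Q_def)
  also have "\<dots> = (\<Sum>j = 0..<N. (?w j \<bullet> s)\<^sup>2)"
    unfolding vec_norm2_power2 scalar_prod_def[of "Q\<^sup>T *\<^sub>v s"]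
    using Q by (intro sum.cong) (auto simp: power2_eq_square Q_def col_arnoldi_W[OF A b])
  also have "\<dots> = (\<Sum>j = m..<N. (?w j \<bullet> s)\<^sup>2)"
    using low by (intro sum.mono_neutral_right) auto
  also have "\<dots> = (\<Sum>i = 0..<N - m. (?w (m + i) \<bullet> s)\<^sup>2)"
    by (rule sum.reindex_bij_witness[of _ "\<lambda>i. m + i" "\<lambda>j. j - m"]) auto
  also have "\<dots> = (vec_norm2 (M\<^sup>T *\<^sub>v u k))\<^sup>2"
    unfolding vec_norm2_power2 scalar_prod_def[of "M\<^sup>T *\<^sub>v u k"]
    using M high by (intro sum.cong) (auto simp: power2_eq_square)
  finally have "vec_norm2 s = vec_norm2 (M\<^sup>T *\<^sub>v u k)" by simp
  also have "\<dots> \<le> spectral_norm M"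
    using vec_norm2_transpose_mult_le[OF M u(1)] u(2) by simp
  finally show ?thesis by (simp add: s_def x_def M_def W_def V_def P_def)
qed

end
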